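(* Let $p\in\mathbb R\setminus\{-\tfrac12,-1,-\tfrac32,\dots\}$, let $P=\begin{pmatrix}\kappa_1&\kappa_3\\ \kappa_3&\kappa_2\end{pmatrix}\in\mathbb R^{2\times2}$ be a symmetric matrix, and let $\psi\in\mathbb R$. Let $\kappa\in\mathbb C$ be a square root of $\det P$, and set $$\sigma=2p\kappa_3-\psi\kappa_1,\qquad \alpha=\frac{\sigma}{2i\kappa}+p\ \text{ if }\kappa\neq0 .$$ Write $\Xi_p(P,\psi)=(A,B)$. (i) If $\det P\ne0$, then $$A(z)=e^{i\kappa z}\Big[\tfrac12M(\alpha,2p+1,-2i\kappa z)+\tfrac12M(\alpha+1,2p+1,-2i\kappa z)-\frac{\kappa_3}{2p+1}\,z\,M(\alpha+1,2p+2,-2i\kappa z)\Big],$$ $$B(z)=e^{i\kappa z}\,\frac{\kappa_1}{2p+1}\,z\,M(\alpha+1,2p+2,-2i\kappa z).$$ (ii) If $\det P=0$, then $$A(z)={}_0F_1(2p+1,-\sigma z)-\frac{\kappa_3}{2p+1}\,z\,{}_0F_1(2p+2,-\sigma z),\qquad B(z)=\frac{\kappa_1}{2p+1}\,z\,{}_0F_1(2p+2,-\sigma z).$$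
   Context: $\mathbb N_0=\{0,1,2,\dots\}$, $J=\begin{pmatrix}0&-1\\1&0\end{pmatrix}$. The confluent hypergeometric (limit) functions are $$M(\alpha,\beta,z)=\sum_{n=0}^\infty\frac{(\alpha)_n}{(\beta)_n}\frac{z^n}{n!},\qquad {}_0F_1(\beta,z)=\sum_{n=0}^\infty\frac1{(\beta)_n}\frac{z^n}{n!},$$ for $\alpha,z\in\mathbb C$, $\beta\in\mathbb C\setminus(-\mathbb N_0)$, where $(\alpha)_0=1$, $(\alpha)_{n+1}=(\alpha)_n(\alpha+n)$. For $p\in\mathbb R\setminus\{-\frac12,-1,-\frac32,\dots\}$ and $(P,\psi)\in\mathbb R^{2\times2}\times\mathbb R$ let $((\alpha_n,\beta_n))_{n\in\mathbb N_0}$ be the sequence of pairs of real numbers given by $(\alpha_0,\beta_0)=(1,0)$ and $$(\alpha_{n+1},\beta_{n+1})=(\alpha_n,\beta_n)\cdot\frac{-1}{(n+1)(2p+n+1)}\,P\,J\begin{pmatrix}2p+n+1&0\\ \psi&n+1\end{pmatrix},\quad n\in\mathbb N_0.$$ Then $\Xi_p(P,\psi)=(A,B)$ denotes the pair of entire functions $A(z)=\sum_n\alpha_nz^n$, $B(z)=\sum_n\beta_nz^n$. *)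

theory Defs
  imports "HOL-Analysis.Analysis"
begin

text \<open>
  Both series converge for all complex \<open>z\<close> as long as \<open>\<beta>\<close> is not a nonpositive integer.
\<close>

definition confluent_M :: "complex \<Rightarrow> complex \<Rightarrow> complex \<Rightarrow> complex" where
  "confluent_M \<alpha> \<beta> z = (\<Sum>n. pochhammer \<alpha> n / pochhammer \<beta> n * (z ^ n / fact n))"

definition hypergeo_0F1 :: "complex \<Rightarrow> complex \<Rightarrow> complex" where
  "hypergeo_0F1 \<beta> z = (\<Sum>n. 1 / pochhammer \<beta> n * (z ^ n / fact n))"

definition mat2 :: "real \<Rightarrow> real \<Rightarrow> real \<Rightarrow> real \<Rightarrow> real^2^2" where
  "mat2 a b c d = vector [vector [a, b], vector [c, d]]"

definition J :: "real^2^2" where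
  "J = mat2 0 (-1) 1 0"

text \<open>
  The pair \<open>(\<alpha>\<^sub>n, \<beta>\<^sub>n)\<close> is encoded as a vector, which multiplies matrices from the left as a row.
\<close>

primrec Xi_coeff :: "real \<Rightarrow> real^2^2 \<Rightarrow> real \<Rightarrow> nat \<Rightarrow> real^2" where
  "Xi_coeff p P \<psi> 0 = vector [1, 0]"
| "Xi_coeff p P \<psi> (Suc n) =
     Xi_coeff p P \<psi> n v*
       ((- 1 / ((real n + 1) * (2 * p + real n + 1))) *\<^sub>R
         (P ** J ** mat2 (2 * p + real n + 1) 0 \<psi> (real n + 1)))"

text \<open>
  The coefficients are bounded by \<open>K * C ^ n / fact n\<close> for some \<open>K, C\<close> when \<open>2 * p\<close> is not a negative integer,
  so both power series converge everywhere.
\<close>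

definition Xi :: "real \<Rightarrow> real^2^2 \<Rightarrow> real \<Rightarrow> (complex \<Rightarrow> complex) \<times> (complex \<Rightarrow> complex)" where
  "Xi p P \<psi> =
     (\<lambda>z. \<Sum>n. complex_of_real (Xi_coeff p P \<psi> n $ 1) * z ^ n,
      \<lambda>z. \<Sum>n. complex_of_real (Xi_coeff p P \<psi> n $ 2) * z ^ n)"

end

theory Submission
  imports Defs
begin

text \<open>
  The recursion says that the generating functions \<open>A\<close>, \<open>B\<close> are the unique power series solution with
  \<open>A(0) = 1\<close>, \<open>B(0) = 0\<close> of the system
  \<open>z A' = - z (\<kappa>\<^sub>3 A + \<kappa>\<^sub>2 B) + \<psi> B\<close>, \<open>z B' + 2 p B = z (\<kappa>\<^sub>1 A + \<kappa>\<^sub>3 B)\<close>.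
  That the claimed expressions solve it follows, as formal power series, from the contiguous
  relations of \<open>M\<close> and \<open>\<^sub>0F\<^sub>1\<close>: these make \<open>z d/dz\<close> act linearly on
  \<open>M(\<alpha> + 1, c, w z)\<close> and \<open>T = z M(\<alpha> + 1, c + 1, w z) / c\<close>, where \<open>c = 2 p + 1\<close> and \<open>w = - 2 i \<kappa>\<close>,
  and \<open>\<kappa>\<^sup>2 = det P\<close> and the choice of \<open>\<alpha>\<close> are exactly what makes the coefficient of \<open>T\<close> vanish.
\<close>

section \<open>Hypergeometric series as formal power series, and their convergence\<close>

text \<open>The scale \<open>w\<close> is part of the coefficients, so that this is a series in
  \<open>z\<close> rather than in \<open>w * z\<close>. All differential relations can then be
  checked coefficientwise, without analysis.\<close>

definition fps_confluent :: "complex \<Rightarrow> complex \<Rightarrow> complex \<Rightarrow> complex fps" where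
  "fps_confluent a c w = Abs_fps (\<lambda>n. pochhammer a n * w ^ n / (pochhammer c n * fact n))"

definition fps_0F1 :: "complex \<Rightarrow> complex \<Rightarrow> complex fps" where
  "fps_0F1 c w = Abs_fps (\<lambda>n. w ^ n / (pochhammer c n * fact n))"

lemma eval_fps_confluent: "eval_fps (fps_confluent a c w) z = confluent_M a c (w * z)"
  unfolding eval_fps_def confluent_M_def fps_confluent_def
  by (intro suminf_cong) (simp add: power_mult_distrib)

lemma eval_fps_0F1: "eval_fps (fps_0F1 c w) z = hypergeo_0F1 c (w * z)"
  unfolding eval_fps_def hypergeo_0F1_def fps_0F1_def
  by (intro suminf_cong) (simp add: power_mult_distrib)

text \<open>Ratio test. The ratio is given as a multiplier \<open>r n\<close> instead of a quotient,
  so vanishing coefficients (terminating series, \<open>w = 0\<close>) cause no trouble.\<close>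

lemma fps_conv_radius_infinity_ratio:
  fixes f :: "complex fps"
  assumes rec: "\<And>n. fps_nth f (Suc n) = r n * fps_nth f n" and "r \<longlonglongrightarrow> 0"
  shows "fps_conv_radius f = \<infinity>"
  unfolding fps_conv_radius_def
proof (rule conv_radius_inftyI'')
  fix z :: complex
  have "(\<lambda>n. r n * z) \<longlonglongrightarrow> 0 * z"
    by (intro tendsto_intros assms)
  then have "eventually (\<lambda>n. norm (r n * z) < 1 / 2) sequentially"
    using order_tendstoD(2)[OF tendsto_norm, of "\<lambda>n. r n * z" 0 sequentially "1/2"] by simp
  then obtain N where N: "\<And>n. n \<ge> N \<Longrightarrow> norm (r n * z) < 1 / 2"
    by (auto simp: eventually_sequentially)
  show "summable (\<lambda>n. fps_nth f n * z ^ n)"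
  proof (rule summable_ratio_test[of "1/2" N])
    fix n assume "N \<le> n"
    have "norm (fps_nth f (Suc n) * z ^ Suc n) = norm (r n * z) * norm (fps_nth f n * z ^ n)"
      by (simp add: rec norm_mult norm_power)
    also have "\<dots> \<le> 1 / 2 * norm (fps_nth f n * z ^ n)"
      using N[OF \<open>N \<le> n\<close>] by (intro mult_right_mono) auto
    finally show "norm (fps_nth f (Suc n) * z ^ Suc n) \<le> 1 / 2 * norm (fps_nth f n * z ^ n)" .
  qed simp
qed

lemma filterlim_add_of_nat_at_infinity:
  "filterlim (\<lambda>n. c + of_nat n :: complex) at_infinity sequentially"
  by (rule tendsto_add_filterlim_at_infinity[OF tendsto_const tendsto_of_nat])

lemma LIMSEQ_inverse_complex_add_of_nat: "(\<lambda>n. 1 / (c + of_nat n :: complex)) \<longlonglongrightarrow> 0"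
  using filterlim_add_of_nat_at_infinity by (rule tendsto_divide_0[OF tendsto_const])

lemma pochhammer_ne_0:
  fixes c :: complex
  assumes "\<And>n::nat. c + of_nat n \<noteq> 0"
  shows "pochhammer c n \<noteq> 0"
  using assms by (auto simp: pochhammer_eq_0_iff eq_neg_iff_add_eq_0)

lemma fps_conv_radius_confluent: "fps_conv_radius (fps_confluent a c w) = \<infinity>"
proof (rule fps_conv_radius_infinity_ratio)
  let ?r = "\<lambda>n. w * ((a + of_nat n) / (c + of_nat n)) * (1 / (1 + of_nat n))"
  show "fps_nth (fps_confluent a c w) (Suc n) = ?r n * fps_nth (fps_confluent a c w) n" for n
    by (simp add: fps_confluent_def pochhammer_Suc divide_inverse mult_ac)
  \<comment> \<open>\<open>c + of_nat n\<close> may vanish for one index, so the rewriting of the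
    quotient as 1 plus a null sequence holds only eventually.\<close>
  have ev: "eventually (\<lambda>n. 1 + (a - c) * (1 / (c + of_nat n)) = (a + of_nat n) / (c + of_nat n)) sequentially"
  proof -
    have "eventually (\<lambda>n. c + of_nat n \<noteq> 0) sequentially"
      by (rule filterlim_at_infinity_imp_eventually_ne[OF filterlim_add_of_nat_at_infinity])
    then show ?thesis
      by eventually_elim (simp add: divide_simps)
  qed
  have "(\<lambda>n. 1 + (a - c) * (1 / (c + of_nat n))) \<longlonglongrightarrow> 1 + (a - c) * 0"
    by (intro tendsto_intros LIMSEQ_inverse_complex_add_of_nat)
  then have "(\<lambda>n. (a + of_nat n) / (c + of_nat n)) \<longlonglongrightarrow> 1"
    using tendsto_cong[OF ev] by simp
  then have "?r \<longlonglongrightarrow> w * 1 * 0"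
    by (intro tendsto_intros LIMSEQ_inverse_complex_add_of_nat)
  then show "?r \<longlonglongrightarrow> 0" by simp
qed

lemma fps_conv_radius_0F1: "fps_conv_radius (fps_0F1 c w) = \<infinity>"
proof (rule fps_conv_radius_infinity_ratio)
  let ?r = "\<lambda>n. w * (1 / (c + of_nat n)) * (1 / (1 + of_nat n))"
  show "fps_nth (fps_0F1 c w) (Suc n) = ?r n * fps_nth (fps_0F1 c w) n" for n
    by (simp add: fps_0F1_def pochhammer_Suc divide_inverse mult_ac)
  have "?r \<longlonglongrightarrow> w * 0 * 0"
    by (intro tendsto_intros LIMSEQ_inverse_complex_add_of_nat)
  then show "?r \<longlonglongrightarrow> 0" by simp
qed

section \<open>Contiguous relations\<close>

lemma pochhammer_contiguous:
  fixes c :: complex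
  assumes "\<And>n::nat. c + of_nat n \<noteq> 0"
  shows "pochhammer (c + 1) n = pochhammer c n * (c + of_nat n) / c"
  using pochhammer_rec[of c n] pochhammer_Suc[of c n] assms[of 0] by (simp add: field_simps)

text \<open>The Euler operator \<open>fps_X * fps_deriv\<close> keeps the index, unlike
  \<open>fps_deriv\<close> alone; this is why every relation below is phrased with it.\<close>

lemma fps_X_mult_deriv_nth: "fps_nth (fps_X * fps_deriv f) n = of_nat n * fps_nth f n"
  by (cases n) auto

text \<open>Coefficientwise this is
  \<open>(c + n) / pochhammer (c + 1) n = c / pochhammer c n\<close>.\<close>

lemma fps_confluent_raise_denominator:
  assumes c: "\<And>n::nat. c + of_nat n \<noteq> 0"
  shows "fps_X * fps_deriv (fps_confluent a (c + 1) w) + fps_const c * fps_confluent a (c + 1) w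
    = fps_const c * fps_confluent a c w"
proof (rule fps_ext)
  fix n
  show "fps_nth (fps_X * fps_deriv (fps_confluent a (c + 1) w) + fps_const c * fps_confluent a (c + 1) w) n
    = fps_nth (fps_const c * fps_confluent a c w) n"
    using c[of 0] c[of n] pochhammer_ne_0[OF c]
    by (simp add: fps_X_mult_deriv_nth fps_confluent_def pochhammer_contiguous[OF c]
        divide_simps) (simp add: algebra_simps)
qed

text \<open>Rests on \<open>pochhammer (a + 1) n - pochhammer a n = n * pochhammer (a + 1) (n -
  1)\<close> together with \<open>pochhammer c n = c * pochhammer (c + 1) (n - 1)\<close> for
  positive \<open>n\<close>.\<close>

lemma fps_confluent_diff:
  assumes c: "\<And>n::nat. c + of_nat n \<noteq> 0"
  shows "fps_const c * (fps_confluent (a + 1) c w - fps_confluent a c w)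
    = fps_const w * fps_X * fps_confluent (a + 1) (c + 1) w"
proof (rule fps_ext)
  fix n
  show "fps_nth (fps_const c * (fps_confluent (a + 1) c w - fps_confluent a c w)) n
    = fps_nth (fps_const w * fps_X * fps_confluent (a + 1) (c + 1) w) n"
  proof (cases n)
    case (Suc m)
    have "pochhammer (a + 1) (Suc m) = pochhammer (a + 1) m * (a + of_nat (Suc m))"
      "pochhammer a (Suc m) = a * pochhammer (a + 1) m"
      "pochhammer c (Suc m) = pochhammer c m * (c + of_nat m)"
      using pochhammer_Suc[of "a + 1" m] pochhammer_rec[of a m] pochhammer_Suc[of c m]
      by (simp_all add: algebra_simps)
    moreover have "1 + of_nat m \<noteq> (0::complex)"
      by (metis of_nat_Suc of_nat_neq_0)
    ultimately show ?thesis
      using Suc c[of 0] c[of m] pochhammer_ne_0[OF c, of m]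
      by (simp add: fps_confluent_def pochhammer_contiguous[OF c] mult.assoc divide_simps)
         (simp add: algebra_simps)
  qed (simp add: fps_confluent_def mult.assoc)
qed

lemma fps_confluent_deriv_raise:
  "fps_X * fps_deriv (fps_confluent a c w)
    = fps_const a * (fps_confluent (a + 1) c w - fps_confluent a c w)"
proof (rule fps_ext)
  fix n
  have "of_nat n * pochhammer a n = a * pochhammer (a + 1) n - a * pochhammer a n"
    using pochhammer_rec[of a n] pochhammer_Suc[of a n] by (simp add: algebra_simps)
  then have "of_nat n * pochhammer a n * w ^ n / (pochhammer c n * fact n)
    = (a * pochhammer (a + 1) n - a * pochhammer a n) * w ^ n / (pochhammer c n * fact n)"
    by simp
  then show "fps_nth (fps_X * fps_deriv (fps_confluent a c w)) n
    = fps_nth (fps_const a * (fps_confluent (a + 1) c w - fps_confluent a c w)) n"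
    by (simp add: fps_X_mult_deriv_nth fps_confluent_def diff_divide_distrib algebra_simps)
qed

lemma fps_confluent_deriv_lower:
  assumes c: "\<And>n::nat. c + of_nat n \<noteq> 0"
  shows "fps_X * fps_deriv (fps_confluent (a + 1) c w)
    = fps_const (c - 1 - a) * (fps_confluent a c w - fps_confluent (a + 1) c w)
      + fps_const w * fps_X * fps_confluent (a + 1) c w"
proof (rule fps_ext)
  fix n
  show "fps_nth (fps_X * fps_deriv (fps_confluent (a + 1) c w)) n
    = fps_nth (fps_const (c - 1 - a) * (fps_confluent a c w - fps_confluent (a + 1) c w)
      + fps_const w * fps_X * fps_confluent (a + 1) c w) n"
  proof (cases n)
    case (Suc m)
    \<comment> \<open>All three coefficients are multiples of \<open>u\<close>. What remains is the
      polynomial identity \<open>n * (a + n) = - (c - 1 - a) * n + (c + n - 1) * n\<close>, where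
      \<open>c + m = c + n - 1\<close>.\<close>
    define u where "u = pochhammer (a + 1) m * w ^ n / (pochhammer c n * fact n)"
    have "fps_nth (fps_confluent a c w) n = a * u"
      using Suc by (simp add: fps_confluent_def u_def pochhammer_rec[of a])
    moreover have "fps_nth (fps_confluent (a + 1) c w) n = (a + of_nat n) * u"
      using Suc pochhammer_Suc[of "a + 1" m] by (simp add: fps_confluent_def u_def mult_ac add_ac)
    moreover have "w * fps_nth (fps_confluent (a + 1) c w) m = (c + of_nat m) * of_nat n * u"
    proof -
      have "pochhammer c n * fact n = (c + of_nat m) * of_nat n * (pochhammer c m * fact m)"
        using Suc by (simp add: pochhammer_Suc mult_ac)
      moreover have "(c + of_nat m) * of_nat n \<noteq> 0"
        using Suc c[of m] by (metis mult_eq_0_iff of_nat_neq_0)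
      ultimately show ?thesis
        using Suc by (simp add: fps_confluent_def u_def del: of_nat_Suc)
    qed
    ultimately show ?thesis
      using Suc by (simp add: fps_X_mult_deriv_nth mult.assoc algebra_simps)
  qed (simp add: fps_confluent_def mult.assoc)
qed

lemma fps_0F1_raise_denominator:
  assumes c: "\<And>n::nat. c + of_nat n \<noteq> 0"
  shows "fps_X * fps_deriv (fps_0F1 (c + 1) w) + fps_const c * fps_0F1 (c + 1) w
    = fps_const c * fps_0F1 c w"
proof (rule fps_ext)
  fix n
  show "fps_nth (fps_X * fps_deriv (fps_0F1 (c + 1) w) + fps_const c * fps_0F1 (c + 1) w) n
    = fps_nth (fps_const c * fps_0F1 c w) n"
    using c[of 0] c[of n] pochhammer_ne_0[OF c]
    by (simp add: fps_X_mult_deriv_nth fps_0F1_def pochhammer_contiguous[OF c]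
        divide_simps) (simp add: algebra_simps)
qed

lemma fps_0F1_deriv:
  assumes c: "\<And>n::nat. c + of_nat n \<noteq> 0"
  shows "fps_const c * (fps_X * fps_deriv (fps_0F1 c w)) = fps_const w * fps_X * fps_0F1 (c + 1) w"
proof (rule fps_ext)
  fix n
  show "fps_nth (fps_const c * (fps_X * fps_deriv (fps_0F1 c w))) n
    = fps_nth (fps_const w * fps_X * fps_0F1 (c + 1) w) n"
  proof (cases n)
    case (Suc m)
    have "1 + of_nat m \<noteq> (0::complex)"
      by (metis of_nat_Suc of_nat_neq_0)
    then show ?thesis
      using Suc c[of 0] c[of m] pochhammer_ne_0[OF c, of m]
      by (simp add: fps_0F1_def pochhammer_contiguous[OF c] pochhammer_Suc mult.assoc divide_simps)
  qed (simp add: fps_0F1_def mult.assoc)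
qed

section \<open>From the matrix recursion to the differential system\<close>

lemma vector_mult_recurrence_matrix:
  fixes v :: "real^2" and k1 k2 k3 q m s \<psi> :: real
  defines "w \<equiv> v v* (s *\<^sub>R (mat2 k1 k3 k3 k2 ** J ** mat2 q 0 \<psi> m))"
  shows "w $ 1 = s * (q * (k3 * v $ 1 + k2 * v $ 2) - \<psi> * (k1 * v $ 1 + k3 * v $ 2))"
    and "w $ 2 = - s * m * (k1 * v $ 1 + k3 * v $ 2)"
  by (simp_all add: w_def J_def mat2_def vector_matrix_mult_def matrix_matrix_mult_def sum_2 algebra_simps)

text \<open>The combination \<open>k1 * a n + k3 * b n\<close> occurs in both components of the
  matrix step. Expressing it through \<open>b (Suc n)\<close> lets the factor
  \<open>2 * p + real n + 1\<close> cancel from the first component, which leaves the coefficient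
  form of the differential system.\<close>

lemma Xi_coeff_Suc:
  fixes p \<psi> k1 k2 k3 :: real
  assumes "2 * p + real n + 1 \<noteq> 0"
  defines "a \<equiv> \<lambda>n. Xi_coeff p (mat2 k1 k3 k3 k2) \<psi> n $ 1"
    and "b \<equiv> \<lambda>n. Xi_coeff p (mat2 k1 k3 k3 k2) \<psi> n $ 2"
  shows "(2 * p + real n + 1) * b (Suc n) = k1 * a n + k3 * b n"
    and "(real n + 1) * a (Suc n) = - (k3 * a n + k2 * b n) + \<psi> * b (Suc n)"
proof -
  show b: "(2 * p + real n + 1) * b (Suc n) = k1 * a n + k3 * b n"
    unfolding a_def b_def Xi_coeff.simps vector_mult_recurrence_matrix
    using assms(1) by (simp add: divide_simps)
  have "(real n + 1) * (2 * p + real n + 1) * a (Suc n)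
    = - (2 * p + real n + 1) * (k3 * a n + k2 * b n) + \<psi> * (k1 * a n + k3 * b n)"
    unfolding a_def b_def Xi_coeff.simps vector_mult_recurrence_matrix
    using assms(1) by (simp add: divide_simps) (simp add: algebra_simps)
  also have "\<dots> = (2 * p + real n + 1) * (- (k3 * a n + k2 * b n) + \<psi> * b (Suc n))"
    unfolding b[symmetric] by (simp add: algebra_simps)
  finally have "(2 * p + real n + 1) * ((real n + 1) * a (Suc n))
    = (2 * p + real n + 1) * (- (k3 * a n + k2 * b n) + \<psi> * b (Suc n))"
    by (simp only: mult_ac)
  then show "(real n + 1) * a (Suc n) = - (k3 * a n + k2 * b n) + \<psi> * b (Suc n)"
    using assms(1) by simp
qed

text \<open>The coefficients of index \<open>Suc n\<close> in the two equations are the relations of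
  \<open>Xi_coeff_Suc\<close>, with nonzero leading factors. At index 0 the equations only give
  \<open>\<psi> * b 0 = 0\<close> and \<open>2 * p * b 0 = 0\<close>, so the initial values are
  prescribed separately.\<close>

lemma Xi_coeff_unique:
  fixes p \<psi> k1 k2 k3 :: real and a b :: "complex fps"
  assumes p: "\<And>n::nat. 2 * p + real n + 1 \<noteq> 0"
    and a0: "fps_nth a 0 = 1" and b0: "fps_nth b 0 = 0"
    and a: "fps_X * fps_deriv a
      = - (fps_X * (fps_const (of_real k3) * a + fps_const (of_real k2) * b)) + fps_const (of_real \<psi>) * b"
    and b: "fps_X * fps_deriv b + fps_const (of_real (2 * p)) * b
      = fps_X * (fps_const (of_real k1) * a + fps_const (of_real k3) * b)"
  shows "of_real (Xi_coeff p (mat2 k1 k3 k3 k2) \<psi> n $ 1) = fps_nth a n \<and>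
    of_real (Xi_coeff p (mat2 k1 k3 k3 k2) \<psi> n $ 2) = fps_nth b n"
proof (induction n)
  case 0
  show ?case by (simp add: a0 b0)
next
  case (Suc n)
  let ?x = "Xi_coeff p (mat2 k1 k3 k3 k2) \<psi> (Suc n)"
  have n: "2 * of_real p + of_nat n + 1 \<noteq> (0::complex)"
  proof -
    have "2 * of_real p + of_nat n + 1 = complex_of_real (2 * p + real n + 1)" by simp
    then show ?thesis using p[of n] of_real_eq_0_iff by metis
  qed
  have n': "of_nat n + 1 \<noteq> (0::complex)"
    by (metis of_nat_Suc of_nat_neq_0 add.commute)
  have b': "(2 * of_real p + of_nat n + 1) * fps_nth b (Suc n)
    = of_real k1 * fps_nth a n + of_real k3 * fps_nth b n"
    using arg_cong[OF b, of "\<lambda>f. fps_nth f (Suc n)"] by (simp add: algebra_simps)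
  have a': "(of_nat n + 1) * fps_nth a (Suc n)
    = - (of_real k3 * fps_nth a n + of_real k2 * fps_nth b n) + of_real \<psi> * fps_nth b (Suc n)"
    using arg_cong[OF a, of "\<lambda>f. fps_nth f (Suc n)"] by (simp add: algebra_simps)
  have "(2 * of_real p + of_nat n + 1) * complex_of_real (?x $ 2)
    = of_real k1 * fps_nth a n + of_real k3 * fps_nth b n"
    using arg_cong[OF Xi_coeff_Suc(1)[OF p, of n k1 k3 k2 \<psi>], of complex_of_real] Suc
    by (simp del: Xi_coeff.simps)
  \<comment> \<open>The second component comes first, because the first one at \<open>Suc n\<close>
    involves it through \<open>\<psi>\<close>.\<close>
  then have B: "of_real (?x $ 2) = fps_nth b (Suc n)"
    unfolding b'[symmetric] mult_left_cancel[OF n] .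
  have "(of_nat n + 1) * complex_of_real (?x $ 1)
    = - (of_real k3 * fps_nth a n + of_real k2 * fps_nth b n) + of_real \<psi> * of_real (?x $ 2)"
    using arg_cong[OF Xi_coeff_Suc(2)[OF p, of n k1 k3 k2 \<psi>], of complex_of_real] Suc
    by (simp del: Xi_coeff.simps)
  then have "of_real (?x $ 1) = fps_nth a (Suc n)"
    unfolding B a'[symmetric] mult_left_cancel[OF n'] .
  with B show ?case by (simp del: Xi_coeff.simps)
qed

lemma Xi_eq_eval_fps:
  assumes "\<And>n. of_real (Xi_coeff p P \<psi> n $ 1) = fps_nth a n \<and> of_real (Xi_coeff p P \<psi> n $ 2) = fps_nth b n"
  shows "Xi p P \<psi> = (eval_fps a, eval_fps b)"
  using assms by (simp add: Xi_def eval_fps_def fun_eq_iff)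

section \<open>The closed forms solve the system\<close>

text \<open>Up to the exponential factor, \<open>a\<close> and \<open>b\<close> are combinations of
  \<open>F1\<close> and \<open>T\<close>. The equation for \<open>b\<close> then holds identically,
  while the one for \<open>a\<close> leaves a multiple of \<open>T\<close> that vanishes by the two
  conditions on \<kappa> and \<alpha>. The condition on \<alpha> is stated with its denominator
  cleared, as it enters there.\<close>

lemma Xi_det_nonzero:
  fixes p \<psi> k1 k2 k3 :: real and \<kappa> \<alpha> :: complex
  assumes p: "\<And>n::nat. 2 * p + real n + 1 \<noteq> 0"
    and \<kappa>: "\<kappa>\<^sup>2 = of_real (k1 * k2 - k3 * k3)"
    and \<alpha>: "of_real (2 * p * k3 - \<psi> * k1) = 2 * \<i> * \<kappa> * (\<alpha> - of_real p)"
  defines "c \<equiv> complex_of_real (2 * p + 1)" and "w \<equiv> - 2 * \<i> * \<kappa>"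
  defines "a \<equiv> fps_exp (\<i> * \<kappa>) * (fps_const (1 / 2) * fps_confluent \<alpha> c w
      + fps_const (1 / 2) * fps_confluent (\<alpha> + 1) c w
      - fps_const (of_real k3 / c) * fps_X * fps_confluent (\<alpha> + 1) (c + 1) w)"
    and "b \<equiv> fps_exp (\<i> * \<kappa>) * (fps_const (of_real k1 / c) * fps_X * fps_confluent (\<alpha> + 1) (c + 1) w)"
  shows "Xi p (mat2 k1 k3 k3 k2) \<psi> = (eval_fps a, eval_fps b)"
proof (rule Xi_eq_eval_fps, rule Xi_coeff_unique[OF p])
  have c: "c + of_nat n \<noteq> 0" for n :: nat
  proof -
    have "c + of_nat n = of_real (2 * p + real n + 1)" by (simp add: c_def)
    then show ?thesis using p[of n] of_real_eq_0_iff by metis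
  qed
  define E where "E = fps_exp (\<i> * \<kappa>)"
  define F0 where "F0 = fps_confluent \<alpha> c w"
  define F1 where "F1 = fps_confluent (\<alpha> + 1) c w"
  define G where "G = fps_confluent (\<alpha> + 1) (c + 1) w"
  \<comment> \<open>Opaque names keep the simplifier from merging constants, so that the later steps
    are plain commutative ring algebra.\<close>
  define C D H K1 K2 K3 S Q Y W :: "complex fps" where
    "C = fps_const c" and "D = fps_const (1 / c)" and "H = fps_const (1 / 2)"
    and "K1 = fps_const (of_real k1)" and "K2 = fps_const (of_real k2)"
    and "K3 = fps_const (of_real k3)" and "S = fps_const \<alpha>"
    and "Q = fps_const (of_real p)" and "Y = fps_const (of_real \<psi>)"
    and "W = fps_const (\<i> * \<kappa>)"
  note const_defs = C_def D_def H_def K1_def K2_def K3_def S_def Q_def Y_def W_def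
  have CD: "C * D = 1" using c[of 0] by (simp add: const_defs)
  have HH: "2 * H = 1"
    by (simp add: const_defs numeral_fps_const)
  have CQ: "C = 2 * Q + 1" by (simp add: const_defs c_def numeral_fps_const)
  have WW: "W * W = - (K1 * K2 - K3 * K3)"
    using \<kappa> by (simp add: const_defs power2_eq_square algebra_simps)
  have SW: "2 * Q * K3 - Y * K1 = 2 * W * (S - Q)"
    using \<alpha> by (simp add: const_defs numeral_fps_const algebra_simps)
  have w: "fps_const w = - (2 * W)" by (simp add: const_defs w_def numeral_fps_const)
  have L1: "fps_X * fps_deriv G + C * G = C * F1"
    using fps_confluent_raise_denominator[OF c, of "\<alpha> + 1" w] by (simp add: const_defs G_def F1_def)
  have L2: "C * (F1 - F0) = - (2 * W) * fps_X * G"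
    using fps_confluent_diff[OF c, of \<alpha> w] unfolding w by (simp add: C_def G_def F1_def F0_def)
  have L3: "fps_X * fps_deriv F0 = S * (F1 - F0)"
    using fps_confluent_deriv_raise[of \<alpha> c w] by (simp add: const_defs F1_def F0_def)
  have L4: "fps_X * fps_deriv F1 = (C - 1 - S) * (F0 - F1) + - (2 * W) * fps_X * F1"
    using fps_confluent_deriv_lower[OF c, of \<alpha> w] unfolding w
    by (simp add: C_def S_def F1_def F0_def flip: fps_const_sub)
  define T where "T = D * fps_X * G"
  \<comment> \<open>Dividing \<open>L2\<close> by \<open>C\<close> eliminates \<open>F0\<close>, so
    only \<open>F1\<close> and \<open>T\<close> remain.\<close>
  have F0: "F0 = F1 + 2 * (W * T)"
  proof -
    have "(D * C) * (F1 - F0) = - (2 * W) * T"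
      using arg_cong[OF L2, of "(*) D"] by (simp only: T_def mult_ac)
    then show ?thesis using CD by (simp add: mult.commute algebra_simps)
  qed
  have dE: "fps_deriv E = W * E" by (simp add: E_def W_def)
  have dD: "fps_deriv D = 0" by (simp add: D_def)
  have dT: "fps_X * fps_deriv T = fps_X * F1 - 2 * Q * T"
  proof -
    \<comment> \<open>Since \<open>C * T = fps_X * D * (C * G)\<close>, adding and subtracting
      \<open>C * T\<close> produces the left side of \<open>L1\<close>.\<close>
    have "fps_X * fps_deriv T = fps_X * D * (fps_X * fps_deriv G + C * G) + T - C * T"
      by (simp add: T_def dD algebra_simps)
    also have "\<dots> = fps_X * (C * D) * F1 - 2 * Q * T"
      unfolding L1 by (simp add: CQ algebra_simps)
    finally show ?thesis by (simp add: CD)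
  qed
  have dF1: "fps_X * fps_deriv F1 = 2 * W * ((2 * Q - S) * T - fps_X * F1)"
    unfolding L4 by (simp add: F0 CQ algebra_simps)
  \<comment> \<open>The mean of \<open>F0\<close> and \<open>F1\<close> contributes the term
    \<open>W * T\<close>, and this is what makes \<open>K1 * a + K3 * b\<close> equal to
    \<open>E * K1 * (F1 + W * T)\<close> in the equation for \<open>b\<close>.\<close>
  have "H * F0 + H * F1 = (2 * H) * (F1 + W * T)"
    by (simp add: F0 algebra_simps)
  then have "H * F0 + H * F1 = F1 + W * T"
    unfolding HH by simp
  moreover have "a = E * (H * F0 + H * F1 - K3 * T)"
    by (simp add: a_def E_def F0_def F1_def G_def T_def const_defs)
  ultimately have a_eq: "a = E * (F1 + (W - K3) * T)"
    by (simp only:) (simp add: algebra_simps)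
  have b_eq: "b = E * (K1 * T)"
    by (simp add: b_def E_def G_def T_def const_defs)
  have dK: "fps_deriv W = 0" "fps_deriv K1 = 0" "fps_deriv K3 = 0"
    by (simp_all add: const_defs)
  have da: "fps_X * fps_deriv a = W * fps_X * E * (F1 + (W - K3) * T)
      + E * (fps_X * fps_deriv F1 + (W - K3) * (fps_X * fps_deriv T))"
    by (simp add: a_eq dE dK algebra_simps)
  have db: "fps_X * fps_deriv b = W * fps_X * E * (K1 * T) + E * K1 * (fps_X * fps_deriv T)"
    by (simp add: b_eq dE dK algebra_simps)
  show "fps_nth a 0 = 1" by (simp add: a_def fps_confluent_def)
  show "fps_nth b 0 = 0" by (simp add: b_def)
  have "fps_X * fps_deriv b + 2 * Q * b = fps_X * (K1 * a + K3 * b)"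
    unfolding db dT unfolding b_eq a_eq by (simp add: algebra_simps)
  then show "fps_X * fps_deriv b + fps_const (of_real (2 * p)) * b
      = fps_X * (fps_const (of_real k1) * a + fps_const (of_real k3) * b)"
    by (simp add: const_defs numeral_fps_const)
  \<comment> \<open>The \<open>F1\<close> terms cancel. The defect is sorted by powers of
    \<open>fps_X\<close>: one bracket vanishes by \<open>WW\<close>, the other by
    \<open>SW\<close>.\<close>
  have "fps_X * fps_deriv a = - (fps_X * (K3 * a + K2 * b)) + Y * b
      + E * T * (fps_X * (W * W + (K1 * K2 - K3 * K3)) + (2 * Q * K3 - Y * K1 - 2 * W * (S - Q)))"
    unfolding da dT dF1 unfolding b_eq a_eq by (simp add: algebra_simps)
  then have "fps_X * fps_deriv a = - (fps_X * (K3 * a + K2 * b)) + Y * b"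
    unfolding WW SW by simp
  then show "fps_X * fps_deriv a
      = - (fps_X * (fps_const (of_real k3) * a + fps_const (of_real k2) * b)) + fps_const (of_real \<psi>) * b"
    by (simp add: const_defs)
qed

text \<open>Same scheme without the exponential and with \<open>F\<close>, \<open>T\<close> as
  basis. The argument is the confluent limit of the previous case: there \<alpha> times
  \<open>w\<close> equals minus \<sigma> minus \<open>2 * \<i> * \<kappa> * p\<close>, which tends
  to minus \<sigma> as \<kappa> tends to 0.\<close>

lemma Xi_det_zero:
  fixes p \<psi> k1 k2 k3 :: real
  assumes p: "\<And>n::nat. 2 * p + real n + 1 \<noteq> 0"
    and det: "k1 * k2 - k3 * k3 = 0"
  defines "c \<equiv> complex_of_real (2 * p + 1)" and "w \<equiv> - complex_of_real (2 * p * k3 - \<psi> * k1)"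
  defines "a \<equiv> fps_0F1 c w - fps_const (of_real k3 / c) * fps_X * fps_0F1 (c + 1) w"
    and "b \<equiv> fps_const (of_real k1 / c) * fps_X * fps_0F1 (c + 1) w"
  shows "Xi p (mat2 k1 k3 k3 k2) \<psi> = (eval_fps a, eval_fps b)"
proof (rule Xi_eq_eval_fps, rule Xi_coeff_unique[OF p])
  have c: "c + of_nat n \<noteq> 0" for n :: nat
  proof -
    have "c + of_nat n = of_real (2 * p + real n + 1)" by (simp add: c_def)
    then show ?thesis using p[of n] of_real_eq_0_iff by metis
  qed
  define F where "F = fps_0F1 c w"
  define G where "G = fps_0F1 (c + 1) w"
  define C D K1 K2 K3 Q Y :: "complex fps" where
    "C = fps_const c" and "D = fps_const (1 / c)"
    and "K1 = fps_const (of_real k1)" and "K2 = fps_const (of_real k2)"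
    and "K3 = fps_const (of_real k3)"
    and "Q = fps_const (of_real p)" and "Y = fps_const (of_real \<psi>)"
  note const_defs = C_def D_def K1_def K2_def K3_def Q_def Y_def
  have CD: "C * D = 1" using c[of 0] by (simp add: const_defs)
  have CQ: "C = 2 * Q + 1" by (simp add: const_defs c_def numeral_fps_const)
  have KK: "K1 * K2 = K3 * K3"
    using det by (simp add: const_defs flip: of_real_mult)
  have w: "fps_const w = - (2 * Q * K3 - Y * K1)"
    by (simp add: const_defs w_def numeral_fps_const)
  have L1: "fps_X * fps_deriv G + C * G = C * F"
    using fps_0F1_raise_denominator[OF c, of w] by (simp add: const_defs G_def F_def)
  have L2: "C * (fps_X * fps_deriv F) = - (2 * Q * K3 - Y * K1) * fps_X * G"
    using fps_0F1_deriv[OF c, of w] unfolding w by (simp add: C_def G_def F_def)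
  define T where "T = D * fps_X * G"
  have dF: "fps_X * fps_deriv F = - (2 * Q * K3 - Y * K1) * T"
  proof -
    have "(C * D) * (fps_X * fps_deriv F) = - (2 * Q * K3 - Y * K1) * T"
      using arg_cong[OF L2, of "(*) D"] by (simp only: T_def mult_ac)
    then show ?thesis by (simp add: CD)
  qed
  have dD: "fps_deriv D = 0" by (simp add: D_def)
  have dT: "fps_X * fps_deriv T = fps_X * F - 2 * Q * T"
  proof -
    have "fps_X * fps_deriv T = fps_X * D * (fps_X * fps_deriv G + C * G) + T - C * T"
      by (simp add: T_def dD algebra_simps)
    also have "\<dots> = fps_X * (C * D) * F - 2 * Q * T"
      unfolding L1 by (simp add: CQ algebra_simps)
    finally show ?thesis by (simp add: CD)
  qed
  have a_eq: "a = F - K3 * T"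
    by (simp add: a_def F_def G_def T_def const_defs)
  have b_eq: "b = K1 * T"
    by (simp add: b_def G_def T_def const_defs)
  have dK: "fps_deriv K1 = 0" "fps_deriv K3 = 0"
    by (simp_all add: const_defs)
  have da: "fps_X * fps_deriv a = fps_X * fps_deriv F - K3 * (fps_X * fps_deriv T)"
    by (simp add: a_eq dK algebra_simps)
  have db: "fps_X * fps_deriv b = K1 * (fps_X * fps_deriv T)"
    by (simp add: b_eq dK algebra_simps)
  show "fps_nth a 0 = 1" by (simp add: a_def fps_0F1_def)
  show "fps_nth b 0 = 0" by (simp add: b_def)
  have "fps_X * fps_deriv b + 2 * Q * b = fps_X * (K1 * a + K3 * b)"
    unfolding db dT unfolding b_eq a_eq by (simp add: algebra_simps)
  then show "fps_X * fps_deriv b + fps_const (of_real (2 * p)) * b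
      = fps_X * (fps_const (of_real k1) * a + fps_const (of_real k3) * b)"
    by (simp add: const_defs numeral_fps_const)
  \<comment> \<open>The parameter \<open>w\<close> already absorbs the terms in \<open>T\<close>
    free of \<open>fps_X\<close>, so the defect is the determinant alone.\<close>
  have "fps_X * fps_deriv a = - (fps_X * (K3 * a + K2 * b)) + Y * b + fps_X * T * (K1 * K2 - K3 * K3)"
    unfolding da dT dF unfolding b_eq a_eq by (simp add: algebra_simps)
  then have "fps_X * fps_deriv a = - (fps_X * (K3 * a + K2 * b)) + Y * b"
    by (simp add: KK)
  then show "fps_X * fps_deriv a
      = - (fps_X * (fps_const (of_real k3) * a + fps_const (of_real k2) * b)) + fps_const (of_real \<psi>) * b"
    by (simp add: const_defs)
qed

section \<open>Back to entire functions\<close>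

theorem theorem4p1:
  fixes p \<psi> \<kappa>\<^sub>1 \<kappa>\<^sub>2 \<kappa>\<^sub>3 \<sigma> :: real
    and P :: "real^2^2"
    and \<kappa> \<alpha> :: complex
    and A B :: "complex \<Rightarrow> complex"
  assumes "\<forall>k::nat. p \<noteq> - (real k + 1) / 2"
    and "P = mat2 \<kappa>\<^sub>1 \<kappa>\<^sub>3 \<kappa>\<^sub>3 \<kappa>\<^sub>2"
    and "\<kappa>\<^sup>2 = of_real (det P)"
    and "\<sigma> = 2 * p * \<kappa>\<^sub>3 - \<psi> * \<kappa>\<^sub>1"
    and "\<kappa> \<noteq> 0 \<longrightarrow> \<alpha> = of_real \<sigma> / (2 * \<i> * \<kappa>) + of_real p"
    and "Xi p P \<psi> = (A, B)"
  shows "(det P \<noteq> 0 \<longrightarrow> (\<forall>z.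
            A z = exp (\<i> * \<kappa> * z) *
              (1 / 2 * confluent_M \<alpha> (2 * of_real p + 1) (- 2 * \<i> * \<kappa> * z)
               + 1 / 2 * confluent_M (\<alpha> + 1) (2 * of_real p + 1) (- 2 * \<i> * \<kappa> * z)
               - of_real \<kappa>\<^sub>3 / (2 * of_real p + 1) * z *
                   confluent_M (\<alpha> + 1) (2 * of_real p + 2) (- 2 * \<i> * \<kappa> * z)) \<and>
            B z = exp (\<i> * \<kappa> * z) * (of_real \<kappa>\<^sub>1 / (2 * of_real p + 1)) * z *
                   confluent_M (\<alpha> + 1) (2 * of_real p + 2) (- 2 * \<i> * \<kappa> * z))) \<and>
         (det P = 0 \<longrightarrow> (\<forall>z.
            A z = hypergeo_0F1 (2 * of_real p + 1) (- of_real \<sigma> * z)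
               - of_real \<kappa>\<^sub>3 / (2 * of_real p + 1) * z *
                   hypergeo_0F1 (2 * of_real p + 2) (- of_real \<sigma> * z) \<and>
            B z = of_real \<kappa>\<^sub>1 / (2 * of_real p + 1) * z *
                   hypergeo_0F1 (2 * of_real p + 2) (- of_real \<sigma> * z)))"
proof -
  have p: "2 * p + real n + 1 \<noteq> 0" for n :: nat
    using assms(1)[rule_format, of n] by (simp add: field_simps)
  have det: "det P = \<kappa>\<^sub>1 * \<kappa>\<^sub>2 - \<kappa>\<^sub>3 * \<kappa>\<^sub>3"
    by (simp add: assms(2) det_2 mat2_def)
  \<comment> \<open>Evaluation respects sums, differences and products only inside the disc of
    convergence; infinite radius is stable under these operations, so the closed forms can be
    evaluated termwise at every \<open>z\<close>.\<close>
  have inf: "fps_conv_radius f = \<infinity> \<Longrightarrow> fps_conv_radius g = \<infinity> \<Longrightarrow> fps_conv_radius (f * g) = \<infinity>"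
    "fps_conv_radius f = \<infinity> \<Longrightarrow> fps_conv_radius g = \<infinity> \<Longrightarrow> fps_conv_radius (f + g) = \<infinity>"
    "fps_conv_radius f = \<infinity> \<Longrightarrow> fps_conv_radius g = \<infinity> \<Longrightarrow> fps_conv_radius (f - g) = \<infinity>"
    for f g :: "complex fps"
    using fps_conv_radius_mult[of f g] fps_conv_radius_add[of f g] fps_conv_radius_diff[of f g] by simp_all
  note eval = inf eval_fps_mult eval_fps_add eval_fps_diff eval_fps_confluent eval_fps_0F1
    fps_conv_radius_confluent fps_conv_radius_0F1
  \<comment> \<open>Matches the parameter \<open>c + 1\<close> of the formal series with the form in
    the statement.\<close>
  have c2: "2 * complex_of_real p + 1 + 1 = 2 * of_real p + 2"
    by simp
  show ?thesis
  proof (intro conjI impI allI)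
    fix z
    assume "det P \<noteq> 0"
    then have "\<kappa> \<noteq> 0" using assms(3) by auto
    then have \<alpha>: "of_real (2 * p * \<kappa>\<^sub>3 - \<psi> * \<kappa>\<^sub>1) = 2 * \<i> * \<kappa> * (\<alpha> - of_real p)"
      using assms(4,5) by simp
    note Xi = Xi_det_nonzero[OF p assms(3)[unfolded det] \<alpha>, folded assms(2), unfolded assms(6)]
    show "A z = exp (\<i> * \<kappa> * z) *
              (1 / 2 * confluent_M \<alpha> (2 * of_real p + 1) (- 2 * \<i> * \<kappa> * z)
               + 1 / 2 * confluent_M (\<alpha> + 1) (2 * of_real p + 1) (- 2 * \<i> * \<kappa> * z)
               - of_real \<kappa>\<^sub>3 / (2 * of_real p + 1) * z *
                   confluent_M (\<alpha> + 1) (2 * of_real p + 2) (- 2 * \<i> * \<kappa> * z))"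
      using Xi by (simp add: eval c2)
    show "B z = exp (\<i> * \<kappa> * z) * (of_real \<kappa>\<^sub>1 / (2 * of_real p + 1)) * z *
                   confluent_M (\<alpha> + 1) (2 * of_real p + 2) (- 2 * \<i> * \<kappa> * z)"
      using Xi by (simp add: eval c2)
  next
    fix z
    assume "det P = 0"
    note Xi = Xi_det_zero[OF p this[unfolded det], of \<psi>, folded assms(2), unfolded assms(6), folded assms(4)]
    show "A z = hypergeo_0F1 (2 * of_real p + 1) (- of_real \<sigma> * z)
               - of_real \<kappa>\<^sub>3 / (2 * of_real p + 1) * z *
                   hypergeo_0F1 (2 * of_real p + 2) (- of_real \<sigma> * z)"
      using Xi by (simp add: eval c2)
    show "B z = of_real \<kappa>\<^sub>1 / (2 * of_real p + 1) * z *
                   hypergeo_0F1 (2 * of_real p + 2) (- of_real \<sigma> * z)"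
      using Xi by (simp add: eval c2)
  qed
qed

end
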